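(* For every Helly graph $G$, $\tau(G)\le 2hb(G)\le \tau(G)+1$. Furthermore, $2hb(G)=\tau(G)+1$ if and only if $\tau(G)$ is odd and $G$ contains the graph $H_3^{k}$ with $k=\lfloor \tau(G)/2\rfloor$ as an isometric subgraph.
   Context: Graphs are finite, connected, unweighted, undirected and simple; $d$ is the shortest-path distance. A subgraph is isometric if it is induced and distance-preserving. A graph is Helly if every family of pairwise intersecting disks $D(v,r)=\{u:d(u,v)\le r\}$ has a common vertex. $hb(G)$ is the maximum over quadruples $u,v,w,x$ of one half of the difference between the two largest of $d(u,v)+d(w,x)$, $d(u,w)+d(v,x)$, $d(u,x)+d(v,w)$. $I(x,y)=\{z: d(x,z)+d(z,y)=d(x,y)\}$, $S_j(x,y)=\{z\in I(x,y): d(x,z)=j\}$, and $\tau(G)=\max\{d(u,v): u,v\in S_j(x,y),\ x,y\in V(G),\ j\in\mathbb{N}\}$. King-grid: the graph on $\mathbb{Z}^2$ in which distinct $(x,y),(x',y')$ are adjacent iff $\max(|x-x'|,|y-y'|)=1$; for $u=(x,y)$ let $s(u)=x+y$, $t(u)=x-y$. For an integer $k\ge0$, $H_3^{k}$ is the subgraph of the King-grid induced by $\{u: 0\le s(u)\le 2k+2,\ -1\le t(u)\le 2k+1\}\cup\{(k,-k-1),(-1,1),(k+1,k+2),(2k+2,0)\}$. *)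

theory Defs
  imports
    "Graph_Theory.Shortest_Path"
    "Graph_Theory.Pair_Digraph"
    "Graph_Theory.Digraph_Isomorphism"
begin

text \<open>
  As in the session Graph_Theory, an undirected graph is a symmetric digraph: the locale
  \<^locale>\<open>graph\<close> says finite, loop-free, without parallel arcs, and symmetric.
  \<^const>\<open>Digraph_Component.connected\<close> includes that there is at least one vertex; its
  name has to be qualified because of the topological notion.
\<close>

subsection \<open>Distances\<close>

text \<open>
  The value is only meaningful if \<open>v\<close> is reachable from \<open>u\<close>; the lemma below
  relates it to the weighted distance of the library, which is an extended real.
\<close>

definition gdist :: "('a, 'b) pre_digraph \<Rightarrow> 'a \<Rightarrow> 'a \<Rightarrow> nat" where
  "gdist G u v = (LEAST n. \<exists>p. pre_digraph.awalk G u p v \<and> length p = n)"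

lemma (in wf_digraph) mu_eq_gdist:
  assumes "u \<rightarrow>\<^sup>* v"
  shows "\<mu> (\<lambda>_. 1) u v = ereal (real (gdist G u v))"
proof -
  have cost: "awalk_cost (\<lambda>_. 1) p = real (length p)" for p :: "'b awalk"
    by (induction p) auto
  obtain p0 where p0: "awalk u p0 v"
    using assms by (auto simp: reachable_awalk)
  obtain p where p: "awalk u p v" "length p = gdist G u v"
    using LeastI_ex[of "\<lambda>n. \<exists>p. awalk u p v \<and> length p = n"] p0
    unfolding gdist_def by blast
  have least: "gdist G u v \<le> length q" if "awalk u q v" for q
    unfolding gdist_def using that by (blast intro: Least_le)
  show ?thesis
    unfolding \<mu>_def cost
  proof (rule antisym)
    show "(INF q\<in>{q. awalk u q v}. ereal (real (length q))) \<le> ereal (real (gdist G u v))"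
      using p by (metis (mono_tags, lifting) INF_lower mem_Collect_eq)
    show "ereal (real (gdist G u v)) \<le> (INF q\<in>{q. awalk u q v}. ereal (real (length q)))"
      using least by (auto intro!: INF_greatest)
  qed
qed

definition disk :: "('a, 'b) pre_digraph \<Rightarrow> 'a \<Rightarrow> nat \<Rightarrow> 'a set" where
  "disk G v r = {u \<in> verts G. gdist G u v \<le> r}"

definition helly :: "('a, 'b) pre_digraph \<Rightarrow> bool" where
  "helly G \<longleftrightarrow>
    (\<forall>F \<subseteq> {disk G v r | v r. v \<in> verts G}.
      (\<forall>A\<in>F. \<forall>B\<in>F. A \<inter> B \<noteq> {}) \<longrightarrow> (\<exists>c\<in>verts G. \<forall>A\<in>F. c \<in> A))"

subsection \<open>Hyperbolicity and interval thinness\<close>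

text \<open>The list of the three sums is sorted increasingly, so the two largest are at 2 and 1.\<close>

definition quad_hb :: "('a, 'b) pre_digraph \<Rightarrow> 'a \<Rightarrow> 'a \<Rightarrow> 'a \<Rightarrow> 'a \<Rightarrow> real" where
  "quad_hb G u v w x =
    (let L = sort [gdist G u v + gdist G w x,
                   gdist G u w + gdist G v x,
                   gdist G u x + gdist G v w]
     in (real (L ! 2) - real (L ! 1)) / 2)"

definition hb :: "('a, 'b) pre_digraph \<Rightarrow> real" where
  "hb G = Max {quad_hb G u v w x | u v w x.
    u \<in> verts G \<and> v \<in> verts G \<and> w \<in> verts G \<and> x \<in> verts G}"

definition interval :: "('a, 'b) pre_digraph \<Rightarrow> 'a \<Rightarrow> 'a \<Rightarrow> 'a set" where
  "interval G x y = {z \<in> verts G. gdist G x z + gdist G z y = gdist G x y}"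

definition slice :: "('a, 'b) pre_digraph \<Rightarrow> nat \<Rightarrow> 'a \<Rightarrow> 'a \<Rightarrow> 'a set" where
  "slice G j x y = {z \<in> interval G x y. gdist G x z = j}"

definition thinness :: "('a, 'b) pre_digraph \<Rightarrow> nat" where
  "thinness G = Max {gdist G u v | u v x y j.
    x \<in> verts G \<and> y \<in> verts G \<and> u \<in> slice G j x y \<and> v \<in> slice G j x y}"

subsection \<open>Isometric subgraphs\<close>

text \<open>
  Connectedness of \<open>H\<close> follows from distance preservation when \<open>G\<close> is connected; it is
  stated explicitly because \<^const>\<open>gdist\<close> is unspecified between different components.
\<close>

definition isometric_subgraph :: "('a, 'b) pre_digraph \<Rightarrow> ('a, 'b) pre_digraph \<Rightarrow> bool" where
  "isometric_subgraph H G \<longleftrightarrow>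
    induced_subgraph H G \<and> Digraph_Component.connected H \<and>
    (\<forall>u\<in>verts H. \<forall>v\<in>verts H. gdist H u v = gdist G u v)"

definition contains_isometric :: "('a, 'b) pre_digraph \<Rightarrow> ('c, 'd) pre_digraph \<Rightarrow> bool" where
  "contains_isometric G K \<longleftrightarrow> (\<exists>H. isometric_subgraph H G \<and> digraph_iso K H)"

subsection \<open>King-grid\<close>

definition king_grid :: "(int \<times> int, (int \<times> int) \<times> (int \<times> int)) pre_digraph" where
  "king_grid = with_proj
    \<lparr> pverts = UNIV,
      parcs = {((x, y), (x', y')) | x y x' y'. max \<bar>x - x'\<bar> \<bar>y - y'\<bar> = 1} \<rparr>"

definition H3_verts :: "nat \<Rightarrow> (int \<times> int) set" where
  "H3_verts k =
    {(x, y) | x y. 0 \<le> x + y \<and> x + y \<le> 2 * int k + 2 \<and> - 1 \<le> x - y \<and> x - y \<le> 2 * int k + 1}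
    \<union> {(int k, - int k - 1), (- 1, 1), (int k + 1, int k + 2), (2 * int k + 2, 0)}"

definition H3 :: "nat \<Rightarrow> (int \<times> int, (int \<times> int) \<times> (int \<times> int)) pre_digraph" where
  "H3 k = king_grid \<restriction> H3_verts k"

end

theory Submission
  imports Defs
begin

text \<open>
  In a Helly graph pairwise close disks have a common vertex. Let \<open>a, b, c, e\<close> be a quadruple
  in which \<open>d a c + d b e\<close> exceeds the other two sums by at least \<open>\<delta>\<close>. Two vertices on geodesics
  from \<open>a\<close> to \<open>c\<close>, both at distance \<open>j\<close> from \<open>a\<close> and as close as possible to \<open>b\<close> and to \<open>e\<close>
  respectively, are at distance at least \<open>\<delta>\<close> as soon as \<open>j\<close> lies in a certain interval with
  half-integral endpoints. If neither this interval nor the one for the pair \<open>b, e\<close> contains an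
  integer, then both small sums agree and all four triangles have odd perimeter. In that case
  moving \<open>j\<close> by one half still yields distance \<open>\<delta> - 1\<close>, and shortening the four
  half-integral whiskers of the quadruple gives four vertices at the distances of the corners
  of \<open>H_3^k\<close>. As \<open>H_3^k\<close> is finite, a nonexpansive map on the corners extends to all of it, and
  the extension is isometric because any two vertices lie on a geodesic between two corners.
\<close>

section \<open>Metric spaces with the disk intersection property\<close>


text \<open>A Helly graph seen through its integer metric only. In the last assumption, pairwise
  intersection of disks is replaced by a numerical condition on centres and radii. Families are sets
  of pairs (centre, radius), so later proofs can write their disks down explicitly.\<close>

locale integer_hyperconvex =
  fixes V :: "'a set" and d :: "'a \<Rightarrow> 'a \<Rightarrow> nat"
  assumes d_refl: "x \<in> V \<Longrightarrow> d x x = 0"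
    and d_sym: "x \<in> V \<Longrightarrow> y \<in> V \<Longrightarrow> d x y = d y x"
    and d_triangle: "x \<in> V \<Longrightarrow> y \<in> V \<Longrightarrow> z \<in> V \<Longrightarrow> d x z \<le> d x y + d y z"
    and disks_meet: "F \<subseteq> V \<times> UNIV \<Longrightarrow> (\<And>x r y s. (x, r) \<in> F \<Longrightarrow> (y, s) \<in> F \<Longrightarrow> d x y \<le> r + s)
      \<Longrightarrow> \<exists>c\<in>V. \<forall>(x, r)\<in>F. d c x \<le> r"
begin

text \<open>Choose \<open>u\<close> in the slice as close as possible to \<open>b\<close>, and
  \<open>v\<close> as close as possible to \<open>e\<close>. Then \<open>d u v\<close> is at least
  \<open>d b e - d b u - d v e\<close>. Each of the last two distances is governed by
  \<open>a\<close> or by \<open>c\<close>: \<open>left\<close> and \<open>right\<close> treat the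
  cases in which both use the same end, and \<open>small\<close> treats the two mixed cases.\<close>

lemma slice_pair:
  fixes \<delta> j :: nat
  assumes V: "a \<in> V" "b \<in> V" "c \<in> V" "e \<in> V"
    and j: "j \<le> d a c"
    and small: "\<delta> + d a b + d c e \<le> d a c + d b e" "\<delta> + d a e + d b c \<le> d a c + d b e"
    and left: "\<delta> + d a b + d a e \<le> d b e + 2 * j"
    and right: "\<delta> + d b c + d c e + 2 * j \<le> d b e + 2 * d a c"
  obtains u v where "u \<in> V" "v \<in> V" "d a u = j" "d a v = j"
    "d a u + d u c = d a c" "d a v + d v c = d a c" "\<delta> \<le> d u v"
proof -
  \<comment> \<open>By the triangle inequality no vertex of the slice is closer to \<open>x\<close>
    than this maximum. The disk around \<open>x\<close> of that radius is still close to those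
    around \<open>a\<close> and \<open>c\<close>, so the bound is attained.\<close>
  have point: "\<exists>u\<in>V. d u a \<le> j \<and> d u c \<le> d a c - j \<and> d u x \<le> max (d a x - j) (d x c - (d a c - j))"
    if x: "x \<in> V" for x
  proof -
    let ?F = "{(a, j), (c, d a c - j), (x, max (d a x - j) (d x c - (d a c - j)))}"
    have "\<exists>u\<in>V. \<forall>(y, r)\<in>?F. d u y \<le> r"
    proof (rule disks_meet)
      show "?F \<subseteq> V \<times> UNIV" using V x by auto
      fix y r z s assume "(y, r) \<in> ?F" "(z, s) \<in> ?F"
      then show "d y z \<le> r + s"
        using V x j by (auto simp: d_refl d_sym[of c a] d_sym[of x a] d_sym[of c x])
    qed
    then show ?thesis by auto
  qed
  from point[OF V(2)] obtain u where u: "u \<in> V" "d u a \<le> j" "d u c \<le> d a c - j"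
    "d u b \<le> max (d a b - j) (d b c - (d a c - j))" by blast
  from point[OF V(4)] obtain v where v: "v \<in> V" "d v a \<le> j" "d v c \<le> d a c - j"
    "d v e \<le> max (d a e - j) (d e c - (d a c - j))" by blast
  have tri: "d a c \<le> d a u + d u c" "d a c \<le> d a v + d v c" "d b e \<le> d b u + d u e"
    "d u e \<le> d u v + d v e"
    using V u(1) v(1) by (simp_all add: d_triangle)
  have tri': "d a c \<le> d a b + d b c" "d a c \<le> d a e + d c e" "d b e \<le> d a b + d a e"
     "d b e \<le> d b c + d c e"
    using d_triangle[of a b c] d_triangle[of a e c] d_triangle[of b a e] d_triangle[of b c e] V
    by (simp_all add: d_sym)
  have sym: "d u a = d a u" "d v a = d a v" "d u b = d b u" "d e c = d c e"
    using V u(1) v(1) by (simp_all add: d_sym)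
  show thesis
  proof (rule that)
    \<comment> \<open>Subtraction in the radii is truncated. As \<open>d a c\<close> \<le>
      \<open>d a b + d b c\<close>, the two true differences are not both negative, so the maximum
      is a true difference; likewise for \<open>e\<close>.\<close>
    have "d b u + j \<le> d a b \<or> d b u + d a c \<le> d b c + j"
      using u(4) tri'(1) j unfolding sym max_def by (auto split: if_splits)
    moreover have "d v e + j \<le> d a e \<or> d v e + d a c \<le> d c e + j"
      using v(4) tri'(2) j unfolding sym max_def by (auto split: if_splits)
    ultimately show "\<delta> \<le> d u v"
      using tri(3,4) small left right by linarith
  qed (use u v tri j sym in auto)
qed

section \<open>Quadruples whose excess is greater than the thinness\<close>

definition thin :: "nat \<Rightarrow> bool" where
  "thin \<tau> \<longleftrightarrow> (\<forall>x\<in>V. \<forall>y\<in>V. \<forall>u\<in>V. \<forall>v\<in>V. d x u + d u y = d x y \<longrightarrow> d x v + d v y = d x y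
    \<longrightarrow> d x u = d x v \<longrightarrow> d u v \<le> \<tau>)"

text \<open>The bounds on \<open>m\<close> say that it is at most the Gromov products at \<open>a\<close>.\<close>

lemma shorten_whisker:
  assumes V: "a \<in> V" "b \<in> V" "c \<in> V" "e \<in> V"
    and m: "m \<le> d a b" "m \<le> d a c" "m \<le> d a e"
      "d b c + 2 * m \<le> d a b + d a c" "d b e + 2 * m \<le> d a b + d a e" "d c e + 2 * m \<le> d a c + d a e"
  obtains a' where "a' \<in> V" "d a' b = d a b - m" "d a' c = d a c - m" "d a' e = d a e - m"
proof -
  let ?F = "{(a, m), (b, d a b - m), (c, d a c - m), (e, d a e - m)}"
  have "\<exists>a'\<in>V. \<forall>(y, r)\<in>?F. d a' y \<le> r"
  proof (rule disks_meet)
    show "?F \<subseteq> V \<times> UNIV" using V by auto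
    fix y r z s assume "(y, r) \<in> ?F" "(z, s) \<in> ?F"
    then show "d y z \<le> r + s"
      using V m by (auto simp: d_refl d_sym[of b a] d_sym[of c a] d_sym[of e a] d_sym[of c b]
          d_sym[of e b] d_sym[of e c])
  qed
  then obtain a' where a': "a' \<in> V" "d a' a \<le> m" "d a' b \<le> d a b - m" "d a' c \<le> d a c - m"
    "d a' e \<le> d a e - m" by auto
  have "d a b \<le> d a' a + d a' b" "d a c \<le> d a' a + d a' c" "d a e \<le> d a' a + d a' e"
    using V a'(1) d_triangle[of a a'] d_sym[of a a'] by auto
  with a' m show thesis by (intro that[of a']) auto
qed

text \<open>These are the king distances between the corners of \<open>H3 k\<close> in cyclic order.
  The diagonals sum to 4k + 6 and each pair of opposite sides to 2k + 4, so the doubled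
  hyperbolicity of the quadruple is 2k + 2.\<close>

definition pinwheel :: "nat \<Rightarrow> 'a \<Rightarrow> 'a \<Rightarrow> 'a \<Rightarrow> 'a \<Rightarrow> bool" where
  "pinwheel k a b c e \<longleftrightarrow> a \<in> V \<and> b \<in> V \<and> c \<in> V \<and> e \<in> V \<and>
    d a b = k + 2 \<and> d b c = k + 2 \<and> d c e = k + 2 \<and> d a e = k + 2 \<and>
    d a c = 2 * k + 3 \<and> d b e = 2 * k + 3"

text \<open>If \<delta> exceeds \<tau>, no integer \<open>j\<close> can satisfy the bounds of
  \<open>slice_pair\<close> for either diagonal. Integrality leaves one way for this to happen, and
  that rigid situation is a pinwheel with whiskers attached to its corners.\<close>

lemma thin_or_pinwheel:
  assumes V: "a \<in> V" "b \<in> V" "c \<in> V" "e \<in> V"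
    and small: "\<delta> + d a b + d c e \<le> d a c + d b e" "\<delta> + d a e + d b c \<le> d a c + d b e"
    and thin: "thin \<tau>"
  shows "\<delta> \<le> \<tau> \<or> (\<delta> = \<tau> + 1 \<and> odd \<tau> \<and> (\<exists>a' b' c' e'. pinwheel (\<tau> div 2) a' b' c' e'))"
proof (rule disjCI)
  assume not: "\<not> (\<delta> = \<tau> + 1 \<and> odd \<tau> \<and> (\<exists>a' b' c' e'. pinwheel (\<tau> div 2) a' b' c' e'))"
  show "\<delta> \<le> \<tau>"
  proof (rule ccontr)
    assume neg: "\<not> \<delta> \<le> \<tau>"
    have sym: "d b a = d a b" "d c a = d a c" "d e a = d a e" "d c b = d b c" "d e b = d b e" "d e c = d c e"
      using V by (simp_all add: d_sym)
    have tri: "d a c \<le> d a b + d b c" "d a c \<le> d a e + d c e" "d b e \<le> d a b + d a e"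
      "d b e \<le> d b c + d c e" "d a b \<le> d a c + d b c" "d a b \<le> d a e + d b e" "d b c \<le> d a b + d a c"
      "d b c \<le> d b e + d c e" "d c e \<le> d a c + d a e" "d c e \<le> d b c + d b e"
      "d a e \<le> d a b + d b e" "d a e \<le> d a c + d c e"
      using V d_triangle[of a b c] d_triangle[of a e c] d_triangle[of b a e] d_triangle[of b c e]
        d_triangle[of a c b] d_triangle[of a e b] d_triangle[of b a c] d_triangle[of b e c]
        d_triangle[of c a e] d_triangle[of c b e] d_triangle[of a b e] d_triangle[of a c e]
      by (simp_all add: sym)
    \<comment> \<open>A parameter \<open>j\<close> as in \<open>slice_pair\<close> cannot exist for either diagonal, since \<open>\<tau> < \<delta>'\<close>.\<close>
    have no_ac: False if jh: "\<tau> < \<delta>'" "\<delta>' \<le> \<delta>" "\<delta>' + d a b + d a e \<le> d b e + 2 * j"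
      "\<delta>' + d b c + d c e + 2 * j \<le> d b e + 2 * d a c" for \<delta>' j
    proof -
      have "j \<le> d a c" "\<delta>' + d a b + d c e \<le> d a c + d b e" "\<delta>' + d a e + d b c \<le> d a c + d b e"
        using jh small tri by linarith+
      then obtain u v where "u \<in> V" "v \<in> V" "d a u = j" "d a v = j"
        "d a u + d u c = d a c" "d a v + d v c = d a c" "\<delta>' \<le> d u v"
        by (rule slice_pair[OF V]) (use jh in auto)
      with thin V \<open>\<tau> < \<delta>'\<close> show False unfolding thin_def by fastforce
    qed
    have no_be: False if jh: "\<tau> < \<delta>'" "\<delta>' \<le> \<delta>" "\<delta>' + d a b + d b c \<le> d a c + 2 * j"
      "\<delta>' + d a e + d c e + 2 * j \<le> d a c + 2 * d b e" for \<delta>' j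
    proof -
      have "j \<le> d b e" "\<delta>' + d b a + d e c \<le> d b e + d a c" "\<delta>' + d b c + d a e \<le> d b e + d a c"
        "\<delta>' + d b a + d b c \<le> d a c + 2 * j" "\<delta>' + d a e + d e c + 2 * j \<le> d a c + 2 * d b e"
        using jh small tri sym by linarith+
      then obtain u v where "u \<in> V" "v \<in> V" "d b u = j" "d b v = j"
        "d b u + d u e = d b e" "d b v + d v e = d b e" "\<delta>' \<le> d u v"
        by (rule slice_pair[OF V(2,1,4,3)]) (use jh in auto)
      with thin V \<open>\<tau> < \<delta>'\<close> show False unfolding thin_def by fastforce
    qed
    \<comment> \<open>The least admissible integers for the lower bounds on \<open>j\<close>; they violate the upper bounds.\<close>
    define w where "w = (\<delta> + d a b + d a e - d b e + 1) div 2"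
    define w' where "w' = (\<delta> + d a b + d b c - d a c + 1) div 2"
    have 1: "\<not> \<delta> + d b c + d c e + 2 * w \<le> d b e + 2 * d a c"
    proof
      assume *: "\<delta> + d b c + d c e + 2 * w \<le> d b e + 2 * d a c"
      have "\<delta> + d a b + d a e \<le> d b e + 2 * w" unfolding w_def by presburger
      with * neg show False using no_ac[of \<delta> w] by auto
    qed
    have 2: "\<not> \<delta> + d a e + d c e + 2 * w' \<le> d a c + 2 * d b e"
    proof
      assume *: "\<delta> + d a e + d c e + 2 * w' \<le> d a c + 2 * d b e"
      have "\<delta> + d a b + d b c \<le> d a c + 2 * w'" unfolding w'_def by presburger
      with * neg show False using no_be[of \<delta> w'] by auto
    qed
    have w: "2 * w + d b e = \<delta> + d a b + d a e \<or> 2 * w + d b e = \<delta> + d a b + d a e + 1"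
      using tri(3) unfolding w_def by linarith
    have w': "2 * w' + d a c = \<delta> + d a b + d b c \<or> 2 * w' + d a c = \<delta> + d a b + d b c + 1"
      using tri(1) unfolding w'_def by linarith
    \<comment> \<open>For both diagonals the admissible \<open>j\<close> form an interval with
      half-integral endpoints whose length is half the total slack in \<open>small\<close>. It
      misses all integers only if its length is 0 and its single point is half of an odd
      integer.\<close>
    have eq: "\<delta> + d a b + d c e = d a c + d b e" "\<delta> + d a e + d b c = d a c + d b e"
      and w_eq: "2 * w + d b e = \<delta> + d a b + d a e + 1" "2 * w' + d a c = \<delta> + d a b + d b c + 1"
      using 1 2 w w' small by linarith+
    \<comment> \<open>Adding the two equations \<open>w_eq\<close> and reducing modulo 2 by the
      second equation of \<open>eq\<close> leaves only \<delta>.\<close>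
    have ev: "even \<delta>" using eq w_eq by presburger
    \<comment> \<open>Lowering \<delta> by 1 moves both endpoints outward by one half, which makes
      \<open>w\<close> admissible.\<close>
    have \<delta>: "\<delta> = \<tau> + 1"
    proof (rule ccontr)
      assume "\<delta> \<noteq> \<tau> + 1"
      with neg have "\<tau> < \<delta> - 1" "\<delta> - 1 + d a b + d a e \<le> d b e + 2 * w"
        "\<delta> - 1 + d b c + d c e + 2 * w \<le> d b e + 2 * d a c"
        using eq w_eq by linarith+
      then show False using no_ac[of "\<delta> - 1" w] by auto
    qed
    define k where "k = \<tau> div 2"
    have k: "\<delta> = 2 * k + 2" and \<tau>: "odd \<tau>"
      using \<delta> ev unfolding k_def by presburger+
    \<comment> \<open>The Gromov products of the two neighbours at each corner, rounded down. The
      perimeters are odd, so the true values are larger by one half.\<close>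
    define ma mb mc me where "ma = (d a b + d a e - d b e) div 2" and "mb = (d a b + d b c - d a c) div 2"
      and "mc = (d b c + d c e - d b e) div 2" and "me = (d a e + d c e - d a c) div 2"
    have m: "d a b + d a e = d b e + 2 * ma + 1" "d a b + d b c = d a c + 2 * mb + 1"
      "d b c + d c e = d b e + 2 * mc + 1" "d a e + d c e = d a c + 2 * me + 1"
    proof -
      have half: "x = y + 2 * ((x - y) div 2) + 1" if "y \<le> x" "odd (x + y)" for x y :: nat
        using that by presburger
      have "d b c + d c e + \<delta> + 2 * w = 2 * d a c + d b e + 1"
        "d a e + d c e + \<delta> + 2 * w' = 2 * d b e + d a c + 1"
        using eq w_eq by linarith+
      then have "odd (d b c + d c e + d b e)" "odd (d a e + d c e + d a c)"
        using ev by presburger+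
      moreover have "odd (d a b + d a e + d b e)" using w_eq(1) ev by presburger
      moreover have "odd (d a b + d b c + d a c)" using w_eq(2) ev by presburger
      ultimately
      show "d a b + d a e = d b e + 2 * ma + 1" "d a b + d b c = d a c + 2 * mb + 1"
        "d b c + d c e = d b e + 2 * mc + 1" "d a e + d c e = d a c + 2 * me + 1"
        using tri(1-4) unfolding ma_def mb_def mc_def me_def by - (rule half; assumption)+
    qed
    \<comment> \<open>Solved for the six distances, the equations show a pinwheel with a whisker at
      each corner. The whiskers are then cut off one at a time, relative to the corners already
      moved.\<close>
    have D: "d a b = k + 2 + ma + mb" "d b c = k + 2 + mb + mc" "d c e = k + 2 + mc + me"
      "d a e = k + 2 + ma + me" "d a c = 2 * k + 3 + ma + mc" "d b e = 2 * k + 3 + mb + me"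
      using m eq k by linarith+
    obtain a' where a': "a' \<in> V" "d a' b = d a b - ma" "d a' c = d a c - ma" "d a' e = d a e - ma"
      by (rule shorten_whisker[OF V, of ma]) (simp_all add: D)
    obtain b' where b': "b' \<in> V" "d b' a' = d b a' - mb" "d b' c = d b c - mb" "d b' e = d b e - mb"
      by (rule shorten_whisker[OF V(2) a'(1) V(3,4), of mb])
        (simp_all add: D a' d_sym[OF V(2) a'(1)])
    have "d a' b' = k + 2"
      using b'(2) a' V(2) b'(1) D by (simp add: d_sym)
    note D' = this a' b' D d_sym[OF V(3) a'(1)] d_sym[OF V(3) b'(1)] d_sym[OF V(4) a'(1)] d_sym[OF V(4) b'(1)]
    obtain c' where c': "c' \<in> V" "d c' a' = d c a' - mc" "d c' b' = d c b' - mc" "d c' e = d c e - mc"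
      by (rule shorten_whisker[OF V(3) a'(1) b'(1) V(4), of mc]) (simp_all add: D')
    have "d a' c' = 2 * k + 3" "d b' c' = k + 2"
      using c' by (simp_all add: D' d_sym[of _ c'])
    note D'' = D' this c' d_sym[OF V(4) c'(1)]
    obtain e' where e': "e' \<in> V" "d e' a' = d e a' - me" "d e' b' = d e b' - me" "d e' c' = d e c' - me"
      by (rule shorten_whisker[OF V(4) a'(1) b'(1) c'(1), of me]) (simp_all add: D'')
    have "d a' e' = k + 2" "d b' e' = 2 * k + 3" "d c' e' = k + 2"
      using e' by (simp_all add: D'' d_sym[of _ e'])
    then have "pinwheel k a' b' c' e'"
      using D'' e'(1) unfolding pinwheel_def by simp
    with not \<tau> \<delta> show False unfolding k_def by blast
  qed
qed

text \<open>The one-point extension argument for hyperconvex spaces. The image of a new point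
  \<open>s\<close> must lie in all disks of radius \<open>e s q\<close> around \<open>g q\<close>;
  these are pairwise close by the triangle inequality for \<open>e\<close>, since \<open>g\<close>
  is nonexpansive so far.\<close>

lemma extend_nonexpansive:
  assumes e_sym: "\<And>p q. e p q = e q p" and e_tri: "\<And>p q r. e p r \<le> e p q + (e q r :: nat)"
    and S: "finite S" and T: "finite T"
    and f: "f ` T \<subseteq> V" "\<And>p q. p \<in> T \<Longrightarrow> q \<in> T \<Longrightarrow> d (f p) (f q) \<le> e p q"
  shows "\<exists>g. (\<forall>p\<in>T. g p = f p) \<and> g ` (T \<union> S) \<subseteq> V \<and>
    (\<forall>p\<in>T \<union> S. \<forall>q\<in>T \<union> S. d (g p) (g q) \<le> e p q)"
  using S
proof induction
  case empty
  then show ?case using f by auto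
next
  case (insert s S)
  then obtain g where g: "\<forall>p\<in>T. g p = f p" "g ` (T \<union> S) \<subseteq> V"
    "\<forall>p\<in>T \<union> S. \<forall>q\<in>T \<union> S. d (g p) (g q) \<le> e p q" by blast
  show ?case
  proof (cases "s \<in> T")
    case True
    then show ?thesis using g by (metis Un_insert_right insert_absorb UnI1)
  next
    case False
    let ?F = "(\<lambda>q. (g q, e s q)) ` (T \<union> S)"
    have "\<exists>c\<in>V. \<forall>(x, r)\<in>?F. d c x \<le> r"
    proof (rule disks_meet)
      show "?F \<subseteq> V \<times> UNIV" using g by auto
      fix x r y t assume "(x, r) \<in> ?F" "(y, t) \<in> ?F"
      then obtain p q where pq: "p \<in> T \<union> S" "q \<in> T \<union> S" "x = g p" "r = e s p" "y = g q" "t = e s q"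
        by auto
      have "d (g p) (g q) \<le> e p q" using g pq by blast
      also have "\<dots> \<le> e p s + e s q" by (rule e_tri)
      finally show "d x y \<le> r + t" using pq e_sym by metis
    qed
    then obtain c where c: "c \<in> V" "\<forall>q\<in>T \<union> S. d c (g q) \<le> e s q" by auto
    have c': "d (g q) c \<le> e q s" if "q \<in> T \<union> S" for q
      using c that g(2) d_sym[of c "g q"] e_sym[of q s] by (metis image_subset_iff)
    have notin: "s \<notin> T \<union> S" using False insert by auto
    let ?g = "g(s := c)"
    have "d (?g p) (?g q) \<le> e p q" if "p \<in> T \<union> insert s S" "q \<in> T \<union> insert s S" for p q
      using that c c' g(3) d_refl[OF c(1)] by auto
    then show ?thesis using g c notin by (intro exI[of _ ?g]) auto
  qed
qed

end


section \<open>Graph distance\<close>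

context wf_digraph
begin

text \<open>Turns walks into powers of the arc relation, which \<open>relpow_add\<close> composes
  and splits. The conjunct \<open>u \<in> verts G\<close> matters for length 0, where the power is
  the identity on the whole type.\<close>

lemma ex_awalk_length_iff:
  "(\<exists>p. awalk u p v \<and> length p = n) \<longleftrightarrow> u \<in> verts G \<and> (u, v) \<in> arcs_ends G ^^ n"
proof (induction n arbitrary: u)
  case 0
  then show ?case by (auto simp: awalk_Nil_iff)
next
  case (Suc n)
  have "(\<exists>p. awalk u p v \<and> length p = Suc n) \<longleftrightarrow>
      (\<exists>e p. e \<in> arcs G \<and> u = tail G e \<and> awalk (head G e) p v \<and> length p = n)"
  proof -
    have "(\<exists>p. awalk u p v \<and> length p = Suc n) \<longleftrightarrow> (\<exists>e p. awalk u (e # p) v \<and> length p = n)"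
      by (metis length_Cons length_Suc_conv)
    then show ?thesis by (simp only: awalk_Cons_iff conj_assoc)
  qed
  also have "\<dots> \<longleftrightarrow> (\<exists>w. (u, w) \<in> arcs_ends G \<and> (w, v) \<in> arcs_ends G ^^ n)"
  proof -
    have "(\<exists>p. awalk (head G e) p v \<and> length p = n) \<longleftrightarrow> (head G e, v) \<in> arcs_ends G ^^ n"
      if "e \<in> arcs G" for e
      using Suc.IH[of "head G e"] that by simp
    moreover have "(u, w) \<in> arcs_ends G \<longleftrightarrow> (\<exists>e\<in>arcs G. u = tail G e \<and> w = head G e)" for w
      by (auto simp: arcs_ends_conv)
    ultimately show ?thesis by metis
  qed
  also have "\<dots> \<longleftrightarrow> u \<in> verts G \<and> (u, v) \<in> arcs_ends G ^^ Suc n"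
    using relpow_Suc_D2[of u v n "arcs_ends G"] relpow_Suc_I2[of u _ "arcs_ends G" v n] adj_in_verts
    by blast
  finally show ?case .
qed

lemma gdist_eq_Least:
  "u \<in> verts G \<Longrightarrow> gdist G u v = (LEAST n. (u, v) \<in> arcs_ends G ^^ n)"
  by (simp add: gdist_def ex_awalk_length_iff)

lemma gdist_le:
  "u \<in> verts G \<Longrightarrow> (u, v) \<in> arcs_ends G ^^ n \<Longrightarrow> gdist G u v \<le> n"
  by (simp add: gdist_eq_Least Least_le)

lemma relpow_gdist:
  assumes "u \<rightarrow>\<^sup>* v"
  shows "(u, v) \<in> arcs_ends G ^^ gdist G u v"
proof -
  have "u \<in> verts G" "\<exists>n. (u, v) \<in> arcs_ends G ^^ n"
    using assms ex_awalk_length_iff[of u v] by (auto simp: reachable_awalk)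
  then show ?thesis
    by (metis gdist_eq_Least LeastI_ex)
qed

lemma gdist_refl: "u \<in> verts G \<Longrightarrow> gdist G u u = 0"
  using gdist_le[of u u 0] by simp

lemma gdist_eq_0: "u \<rightarrow>\<^sup>* v \<Longrightarrow> gdist G u v = 0 \<Longrightarrow> u = v"
  using relpow_gdist[of u v] by simp

lemma gdist_triangle:
  assumes "u \<rightarrow>\<^sup>* v" "v \<rightarrow>\<^sup>* w"
  shows "gdist G u w \<le> gdist G u v + gdist G v w"
  using relpow_gdist[OF assms(1)] relpow_gdist[OF assms(2)] reachable_in_verts[OF assms(1)]
  by (intro gdist_le) (auto simp: relpow_add)

lemma gdist_eq_1_iff:
  assumes "u \<rightarrow>\<^sup>* v"
  shows "gdist G u v = 1 \<longleftrightarrow> u \<noteq> v \<and> (u, v) \<in> arcs_ends G"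
proof
  assume "gdist G u v = 1"
  then show "u \<noteq> v \<and> (u, v) \<in> arcs_ends G"
    using relpow_gdist[OF assms] gdist_refl reachable_in_verts[OF assms] by auto
next
  assume "u \<noteq> v \<and> (u, v) \<in> arcs_ends G"
  then have "gdist G u v \<le> 1" "gdist G u v \<noteq> 0"
    using gdist_le[of u v 1] gdist_eq_0[OF assms] reachable_in_verts[OF assms] by auto
  then show "gdist G u v = 1" by simp
qed

text \<open>A shortest walk can be cut after any number of steps. This is what makes two disks meet
  as soon as their radii add up to the distance of the centres.\<close>

lemma gdist_split:
  assumes "u \<rightarrow>\<^sup>* v" "gdist G u v = m + n"
  obtains w where "w \<in> verts G" "gdist G u w \<le> m" "gdist G w v \<le> n"
proof -
  obtain w where w: "(u, w) \<in> arcs_ends G ^^ m" "(w, v) \<in> arcs_ends G ^^ n"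
    using relpow_gdist[OF assms(1)] assms(2) by (auto simp: relpow_add)
  have "u \<in> verts G" using assms(1) by (rule reachable_in_verts)
  moreover have "w \<in> verts G"
    using w(1) calculation by (cases m) auto
  ultimately show thesis using w gdist_le that by blast
qed

lemma strongly_connected_imp_connected:
  assumes "strongly_connected G"
  shows "Digraph_Component.connected G"
proof -
  have "arcs_ends G \<subseteq> (arcs_ends G)\<^sup>s" by (auto simp: symcl_def)
  from rtrancl_on_mono[OF this order_refl] show ?thesis
    using assms unfolding connected_conv strongly_connected_def reachable_def by blast
qed

section \<open>Isomorphic copies and isometric embeddings\<close>

lemma gdist_app_iso:
  assumes hom: "digraph_isomorphism hom" and uv: "u \<in> verts G" "v \<in> verts G"
  shows "gdist (app_iso hom G) (iso_verts hom u) (iso_verts hom v) = gdist G u v"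
proof -
  have "(\<exists>p. pre_digraph.awalk (app_iso hom G) (iso_verts hom u) p (iso_verts hom v) \<and> length p = n)
    \<longleftrightarrow> (\<exists>p. awalk u p v \<and> length p = n)" for n
    using awalk_app_isoI[OF _ hom, of u _ v] awalk_app_isoD[OF _ hom, of "iso_verts hom u" _ "iso_verts hom v"] hom uv
    by (metis length_map iso_verts_inv_iso)
  then show ?thesis unfolding gdist_def by simp
qed

lemma strongly_connected_app_iso:
  assumes hom: "digraph_isomorphism hom" and "strongly_connected G"
  shows "strongly_connected (app_iso hom G)"
proof -
  interpret H: wf_digraph "app_iso hom G" using hom ..
  have "iso_verts hom u \<rightarrow>\<^sup>*\<^bsub>app_iso hom G\<^esub> iso_verts hom v" if "u \<in> verts G" "v \<in> verts G" for u v
  proof -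
    have "u \<rightarrow>\<^sup>* v" using assms(2) that by (auto simp: strongly_connected_def)
    then show ?thesis
      using awalk_app_isoI[OF _ hom] unfolding H.reachable_awalk reachable_awalk by blast
  qed
  then show ?thesis
    using assms(2) by (auto simp: strongly_connected_def)
qed

end

lemma (in sym_digraph) gdist_sym:
  assumes "u \<rightarrow>\<^sup>* v"
  shows "gdist G u v = gdist G v u"
proof -
  have "(x, y) \<in> arcs_ends G ^^ n \<Longrightarrow> (y, x) \<in> arcs_ends G ^^ n" for x y n
  proof (induction n arbitrary: y)
    case (Suc n)
    then obtain z where "(x, z) \<in> arcs_ends G ^^ n" "(z, y) \<in> arcs_ends G"
      by auto
    then show ?case
      using Suc.IH arcs_ends_symmetric[OF sym_arcs] relpow_Suc_I2 by metis
  qed simp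
  then have "(u, v) \<in> arcs_ends G ^^ n \<longleftrightarrow> (v, u) \<in> arcs_ends G ^^ n" for n by blast
  then show ?thesis
    using reachable_in_verts[OF assms] by (simp add: gdist_eq_Least)
qed

text \<open>A distance-preserving map is injective, as distance 0 means equality, and respects
  adjacency both ways, as adjacency means distance 1. Without parallel arcs the vertex map
  determines the arc map, so the image induces a copy of \<open>K\<close>.\<close>

lemma contains_isometric_iff:
  assumes "graph G" "Digraph_Component.connected G"
    and "loopfree_digraph K" "nomulti_digraph K" "strongly_connected K"
  shows "contains_isometric G K \<longleftrightarrow> (\<exists>f. f ` verts K \<subseteq> verts G \<and>
    (\<forall>p\<in>verts K. \<forall>q\<in>verts K. gdist G (f p) (f q) = gdist K p q))"
proof
  interpret K: wf_digraph K using assms(3) by (simp add: loopfree_digraph_def)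
  assume "contains_isometric G K"
  then obtain hom where hom: "K.digraph_isomorphism hom" "isometric_subgraph (app_iso hom K) G"
    unfolding contains_isometric_def digraph_iso_def by blast
  then have "iso_verts hom ` verts K \<subseteq> verts G"
    unfolding isometric_subgraph_def induced_subgraph_def subgraph_def by simp
  moreover have "gdist G (iso_verts hom p) (iso_verts hom q) = gdist K p q"
    if "p \<in> verts K" "q \<in> verts K" for p q
    using hom(2) K.gdist_app_iso[OF hom(1) that] that unfolding isometric_subgraph_def by simp
  ultimately show "\<exists>f. f ` verts K \<subseteq> verts G \<and>
    (\<forall>p\<in>verts K. \<forall>q\<in>verts K. gdist G (f p) (f q) = gdist K p q)" by blast
next
  interpret K: loopfree_digraph K by fact
  interpret Kn: nomulti_digraph K by fact
  interpret G: graph G by fact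
  have scG: "strongly_connected G"
    using G.sym_arcs assms(2) by (rule G.symmetric_connected_imp_strongly_connected)
  assume "\<exists>f. f ` verts K \<subseteq> verts G \<and>
    (\<forall>p\<in>verts K. \<forall>q\<in>verts K. gdist G (f p) (f q) = gdist K p q)"
  then obtain f where f: "f ` verts K \<subseteq> verts G"
    and dist: "\<And>p q. p \<in> verts K \<Longrightarrow> q \<in> verts K \<Longrightarrow> gdist G (f p) (f q) = gdist K p q"
    by blast
  have rK: "p \<rightarrow>\<^sup>*\<^bsub>K\<^esub> q" if "p \<in> verts K" "q \<in> verts K" for p q
    using assms(5) that by (auto simp: strongly_connected_def)
  have rG: "p \<rightarrow>\<^sup>*\<^bsub>G\<^esub> q" if "p \<in> verts G" "q \<in> verts G" for p q
    using scG that by (auto simp: strongly_connected_def)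
  have inj: "inj_on f (verts K)"
  proof (rule inj_onI)
    fix p q assume pq: "p \<in> verts K" "q \<in> verts K" "f p = f q"
    then have "gdist K p q = 0"
      using dist[of p q] f G.gdist_refl[of "f q"] by (metis image_subset_iff)
    then show "p = q" using K.gdist_eq_0 rK pq by blast
  qed
  have adj: "f p \<rightarrow>\<^bsub>G\<^esub> f q \<longleftrightarrow> p \<rightarrow>\<^bsub>K\<^esub> q" if "p \<in> verts K" "q \<in> verts K" for p q
  proof -
    have "f p \<in> verts G" "f q \<in> verts G" using f that by auto
    then show ?thesis
      using G.gdist_eq_1_iff[of "f p" "f q"] K.gdist_eq_1_iff[of p q] dist[OF that] rG rK that
        G.adj_not_same K.adj_not_same by metis
  qed
  define g where "g a = (SOME e. e \<in> arcs G \<and> arc_to_ends G e = (f (tail K a), f (head K a)))" for a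
  have g: "g a \<in> arcs G" "tail G (g a) = f (tail K a)" "head G (g a) = f (head K a)"
    if "a \<in> arcs K" for a
  proof -
    have "tail K a \<rightarrow>\<^bsub>K\<^esub> head K a" using that by (auto simp: arcs_ends_conv)
    then have "\<exists>e. e \<in> arcs G \<and> arc_to_ends G e = (f (tail K a), f (head K a))"
      using adj[of "tail K a" "head K a"] that by (auto simp: arcs_ends_def)
    from someI_ex[OF this] show "g a \<in> arcs G" "tail G (g a) = f (tail K a)" "head G (g a) = f (head K a)"
      unfolding g_def arc_to_ends_def by auto
  qed
  define hom where "hom = \<lparr>iso_verts = f, iso_arcs = g, iso_head = head G, iso_tail = tail G\<rparr>"
  have hom: "K.digraph_isomorphism hom"
    unfolding K.digraph_isomorphism_def
  proof (intro conjI ballI)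
    show "inj_on (iso_arcs hom) (arcs K)"
    proof (rule inj_onI)
      fix a b assume ab: "a \<in> arcs K" "b \<in> arcs K" "iso_arcs hom a = iso_arcs hom b"
      then have "f (tail K a) = f (tail K b)" "f (head K a) = f (head K b)"
        using g by (simp_all add: hom_def) metis+
      then have "arc_to_ends K a = arc_to_ends K b"
        using inj_onD[OF inj] ab by (simp add: arc_to_ends_def)
      then show "a = b" using Kn.no_multi_arcs ab by blast
    qed
  qed (use inj g in \<open>auto simp: hom_def K.wf_digraph_axioms\<close>)
  define H where "H = G \<restriction> (f ` verts K)"
  have "e \<in> g ` arcs K" if eH: "e \<in> arcs H" for e
  proof -
    have e: "e \<in> arcs G" using eH by (simp add: H_def)
    obtain p q where pq: "p \<in> verts K" "q \<in> verts K" "tail G e = f p" "head G e = f q"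
    proof -
      have "tail G e \<in> f ` verts K" "head G e \<in> f ` verts K" using eH by (simp_all add: H_def)
      then show thesis using that by blast
    qed
    then have "p \<rightarrow>\<^bsub>K\<^esub> q" using adj[OF pq(1,2)] e by (force simp: arcs_ends_conv)
    then obtain a where "a \<in> arcs K" "tail K a = p" "head K a = q"
      by (auto simp: arcs_ends_conv)
    then have "arc_to_ends G (g a) = arc_to_ends G e" "a \<in> arcs K" "g a \<in> arcs G"
      using g pq by (auto simp: arc_to_ends_def)
    then show ?thesis using G.no_multi_arcs e by blast
  qed
  then have "arcs H = g ` arcs K"
    using g by (auto simp: H_def)
  \<comment> \<open>\<open>hom\<close> carries the head and tail functions of \<open>G\<close>, so
    the induced subgraph equals the image of \<open>K\<close> outright.\<close>
  then have H: "H = app_iso hom K"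
    by (intro pre_digraph.equality) (auto simp: hom_def H_def)
  have ind: "induced_subgraph H G"
    unfolding H_def using f by (rule G.induced_induce)
  interpret H: wf_digraph H using ind by (rule wf_digraphI_induced)
  have "Digraph_Component.connected H"
    using K.strongly_connected_app_iso[OF hom assms(5)] H.strongly_connected_imp_connected H by simp
  moreover have "gdist H u v = gdist G u v" if "u \<in> verts H" "v \<in> verts H" for u v
  proof -
    obtain p q where pq: "p \<in> verts K" "q \<in> verts K" "u = f p" "v = f q"
      using \<open>u \<in> verts H\<close> \<open>v \<in> verts H\<close> by (auto simp: H_def)
    then show ?thesis using K.gdist_app_iso[OF hom pq(1,2)] dist[OF pq(1,2)] H by (simp add: hom_def)
  qed
  ultimately have "isometric_subgraph H G"
    using ind unfolding isometric_subgraph_def by blast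
  then show "contains_isometric G K"
    using hom H unfolding contains_isometric_def digraph_iso_def by blast
qed


section \<open>The graph \<open>H_3^k\<close>\<close>

text \<open>
  In the coordinates \<open>s = x + y\<close>, \<open>t = x - y\<close> the king metric is half of the taxicab metric.
\<close>

definition H3_region :: "int \<Rightarrow> int \<Rightarrow> int \<Rightarrow> bool" where
  "H3_region k s t \<longleftrightarrow> (0 \<le> s \<and> s \<le> 2 * k + 2 \<and> - 1 \<le> t \<and> t \<le> 2 * k + 1) \<or>
    (s = - 1 \<and> t = 2 * k + 1) \<or> (s = 0 \<and> t = - 2) \<or> (s = 2 * k + 3 \<and> t = - 1) \<or> (s = 2 * k + 2 \<and> t = 2 * k + 2)"

text \<open>The quarter turn about the centre permutes the four corners.\<close>

lemma H3_region_rotateI: "H3_region k s t \<Longrightarrow> H3_region k (2 * k + 1 - t) (s - 1)"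
  unfolding H3_region_def by auto

text \<open>The quarter turn has order four, so three further turns undo it.\<close>

lemma H3_region_rotate: "H3_region k (2 * k + 1 - t) (s - 1) \<longleftrightarrow> H3_region k s t"
proof
  assume "H3_region k (2 * k + 1 - t) (s - 1)"
  from this[THEN H3_region_rotateI, THEN H3_region_rotateI, THEN H3_region_rotateI]
  show "H3_region k s t" by (simp add: algebra_simps)
qed (rule H3_region_rotateI)

text \<open>A king move has taxicab length 2 in these coordinates: two units in one coordinate or
  one unit in each. The move asked for is the first step of a geodesic to the target.\<close>

definition H3_step_towards :: "int \<Rightarrow> int \<Rightarrow> int \<Rightarrow> int \<Rightarrow> int \<Rightarrow> bool" where
  "H3_step_towards k s' t' s t \<longleftrightarrow> (\<exists>a b. \<bar>a\<bar> + \<bar>b\<bar> = 2 \<and> H3_region k (s + a) (t + b) \<and>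
    \<bar>s - s'\<bar> + \<bar>t - t'\<bar> = \<bar>s + a - s'\<bar> + \<bar>t + b - t'\<bar> + 2)"

lemma H3_step_towards_rotate:
  assumes "H3_step_towards k (2 * k + 1 - t') (s' - 1) (2 * k + 1 - t) (s - 1)"
  shows "H3_step_towards k s' t' s t"
proof -
  obtain a b where ab: "\<bar>a\<bar> + \<bar>b\<bar> = 2" "H3_region k (2 * k + 1 - t + a) (s - 1 + b)"
    "\<bar>2 * k + 1 - t - (2 * k + 1 - t')\<bar> + \<bar>s - 1 - (s' - 1)\<bar> =
      \<bar>2 * k + 1 - t + a - (2 * k + 1 - t')\<bar> + \<bar>s - 1 + b - (s' - 1)\<bar> + 2"
    using assms unfolding H3_step_towards_def by blast
  have "2 * k + 1 - t + a = 2 * k + 1 - (t + (- a))" "s - 1 + b = (s + b) - 1" by auto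
  then have "H3_region k (s + b) (t + (- a))"
    using ab(2) H3_region_rotate by metis
  moreover have "\<bar>s - s'\<bar> + \<bar>t - t'\<bar> = \<bar>s + b - s'\<bar> + \<bar>t + (- a) - t'\<bar> + 2" "\<bar>b\<bar> + \<bar>- a\<bar> = 2"
  proof -
    have e: "\<bar>2 * k + 1 - t - (2 * k + 1 - t')\<bar> = \<bar>t - t'\<bar>" "s - 1 - (s' - 1) = s - s'"
      "\<bar>2 * k + 1 - t + a - (2 * k + 1 - t')\<bar> = \<bar>t + (- a) - t'\<bar>" "s - 1 + b - (s' - 1) = s + b - s'"
      by linarith+
    show "\<bar>s - s'\<bar> + \<bar>t - t'\<bar> = \<bar>s + b - s'\<bar> + \<bar>t + (- a) - t'\<bar> + 2"
      using ab(3)[unfolded e] by (simp only: ac_simps)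
    show "\<bar>b\<bar> + \<bar>- a\<bar> = 2"
      using ab(1) by simp
  qed
  ultimately show ?thesis unfolding H3_step_towards_def by blast
qed

text \<open>The move (1, 1) is tried first. If it overshoots or leaves the region, then either both
  points have the same \<open>t\<close>, and parity leaves room for two units of \<open>s\<close>,
  or the start is in the row just below the tip at \<open>t = 2 * k + 2\<close>. In both cases the
  move (2, 0) works.\<close>

lemma H3_region_step_quadrant:
  fixes k s t s' t' :: int
  assumes k: "k \<ge> 0"
    and p: "H3_region k s t" and q: "H3_region k s' t'" and par: "even (s + t)" "even (s' + t')"
    and less: "s < s'" "t \<le> t'"
  shows "H3_step_towards k s' t' s t"
proof (cases "t < t' \<and> H3_region k (s + 1) (t + 1)")
  case True
  then show ?thesis using less unfolding H3_step_towards_def by (intro exI[of _ 1]) auto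
next
  case False
  have p': "(0 \<le> s \<and> s \<le> 2 * k + 2 \<and> - 1 \<le> t \<and> t \<le> 2 * k + 1) \<or> (s = - 1 \<and> t = 2 * k + 1) \<or> (s = 0 \<and> t = - 2)"
    using p q less k unfolding H3_region_def by auto
  have q': "s' \<le> 2 * k + 2 \<and> t' \<le> 2 * k + 1 \<or> s' = 2 * k + 2 \<and> t' = 2 * k + 2 \<or> s' = 2 * k + 3 \<and> t' = - 1"
    using q k by (auto simp: H3_region_def)
  have "t = t' \<or> (t = 2 * k + 1 \<and> t' = 2 * k + 2)"
  proof (rule ccontr)
    assume "\<not> ?thesis"
    then have "t < t'" "t' \<le> 2 * k + 1 \<or> t \<le> 2 * k" using less p' q' by auto
    then have "t \<le> 2 * k" by auto
    moreover have "0 \<le> s" "- 2 \<le> t" using p' calculation by auto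
    moreover have "s \<le> 2 * k + 1" using p' q' less \<open>t < t'\<close> k by linarith
    ultimately have "H3_region k (s + 1) (t + 1)" unfolding H3_region_def by simp
    with False \<open>t < t'\<close> show False by simp
  qed
  then have "s + 2 \<le> s' \<and> H3_region k (s + 2) t"
  proof
    assume t: "t = t'"
    then have "s + 2 \<le> s'" using less par by presburger
    moreover have "H3_region k (s + 2) t"
    proof -
      have "- 1 \<le> t" using p' q t less k unfolding H3_region_def by linarith
      moreover have "t \<le> 2 * k + 1" "0 \<le> s + 2" using p' k by linarith+
      moreover have "s + 2 \<le> 2 * k + 2 \<or> s + 2 = 2 * k + 3 \<and> t = - 1"
        using q' t \<open>s + 2 \<le> s'\<close> by linarith
      ultimately show ?thesis unfolding H3_region_def by blast
    qed
    ultimately show ?thesis by blast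
  next
    assume t: "t = 2 * k + 1 \<and> t' = 2 * k + 2"
    then have s: "s' = 2 * k + 2" using q k unfolding H3_region_def by linarith
    have "s + 1 \<noteq> s'"
      using False s t unfolding H3_region_def by auto
    then have "s + 2 \<le> 2 * k + 2" using s less by simp
    moreover have "- 1 \<le> s" using p' k by linarith
    ultimately show ?thesis using s t k unfolding H3_region_def by auto
  qed
  then show ?thesis using less unfolding H3_step_towards_def by (intro exI[of _ 2] exI[of _ 0]) auto
qed

lemma H3_region_step:
  fixes k s t s' t' :: int
  assumes k: "k \<ge> 0"
    and p: "H3_region k s t" and q: "H3_region k s' t'" and par: "even (s + t)" "even (s' + t')"
    and ne: "(s, t) \<noteq> (s', t')"
  shows "H3_step_towards k s' t' s t"
proof -
  have rotated: "H3_region k (2 * k + 1 - t) (s - 1)" "H3_region k (2 * k + 1 - t') (s' - 1)"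
    "even (2 * k + 1 - t + (s - 1))" "even (2 * k + 1 - t' + (s' - 1))"
    if "H3_region k s t" "H3_region k s' t'" "even (s + t)" "even (s' + t')" for s t s' t'
    using that by (auto simp: H3_region_rotate)
  note quadrant = H3_region_step_quadrant[OF k]
  note R1 = rotated[OF p q par]
  note R2 = rotated[OF R1]
  note R3 = rotated[OF R2]
  \<comment> \<open>Four half-open quadrants around the start cover all targets; zero to three
    quarter turns carry them to the first one.\<close>
  consider "s < s'" "t \<le> t'" | "t' < t" "s \<le> s'" | "s' < s" "t' \<le> t" | "t < t'" "s' \<le> s"
    using ne by fastforce
  then show ?thesis
  proof cases
    case 1
    then show ?thesis by (intro quadrant p q par)
  next
    case 2
    then have "H3_step_towards k (2 * k + 1 - t') (s' - 1) (2 * k + 1 - t) (s - 1)"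
      by (intro quadrant[OF R1]) auto
    then show ?thesis by (rule H3_step_towards_rotate)
  next
    case 3
    then have "H3_step_towards k (2 * k + 1 - (s' - 1)) (2 * k + 1 - t' - 1) (2 * k + 1 - (s - 1)) (2 * k + 1 - t - 1)"
      by (intro quadrant[OF R2]) auto
    then show ?thesis by (rule H3_step_towards_rotate[OF H3_step_towards_rotate])
  next
    case 4
    then have "H3_step_towards k (2 * k + 1 - (2 * k + 1 - t' - 1)) (2 * k + 1 - (s' - 1) - 1)
      (2 * k + 1 - (2 * k + 1 - t - 1)) (2 * k + 1 - (s - 1) - 1)"
      by (intro quadrant[OF R3]) auto
    then show ?thesis by (rule H3_step_towards_rotate[OF H3_step_towards_rotate[OF H3_step_towards_rotate]])
  qed
qed

text \<open>In the coordinates \<open>s\<close>, \<open>t\<close> one pair of opposite corners is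
  (0, -2), (2k + 2, 2k + 2) and the other is (-1, 2k + 1), (2k + 3, -1). Points ordered alike in
  both coordinates fit between the first pair, points ordered oppositely between the second.
  Neighbouring corners fit neither way, hence \<open>grid\<close>.\<close>

lemma H3_region_between:
  fixes k s t s' t' :: int
  assumes k: "k \<ge> 0" and p: "H3_region k s t" and q: "H3_region k s' t'"
    and grid: "(0 \<le> s \<and> s \<le> 2 * k + 2 \<and> - 1 \<le> t \<and> t \<le> 2 * k + 1) \<or> (0 \<le> s' \<and> s' \<le> 2 * k + 2 \<and> - 1 \<le> t' \<and> t' \<le> 2 * k + 1)"
  shows "(0 \<le> s \<and> s \<le> s' \<and> s' \<le> 2 * k + 2 \<and> - 2 \<le> t \<and> t \<le> t' \<and> t' \<le> 2 * k + 2) \<or>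
    (0 \<le> s' \<and> s' \<le> s \<and> s \<le> 2 * k + 2 \<and> - 2 \<le> t' \<and> t' \<le> t \<and> t \<le> 2 * k + 2) \<or>
    (- 1 \<le> s \<and> s \<le> s' \<and> s' \<le> 2 * k + 3 \<and> - 1 \<le> t' \<and> t' \<le> t \<and> t \<le> 2 * k + 1) \<or>
    (- 1 \<le> s' \<and> s' \<le> s \<and> s \<le> 2 * k + 3 \<and> - 1 \<le> t \<and> t \<le> t' \<and> t' \<le> 2 * k + 1)"
  using assms unfolding H3_region_def by (smt (verit))


section \<open>The king metric and distances in \<open>H3 k\<close>\<close>

definition king_dist :: "int \<times> int \<Rightarrow> int \<times> int \<Rightarrow> nat" where
  "king_dist p q = nat (max \<bar>fst p - fst q\<bar> \<bar>snd p - snd q\<bar>)"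

lemma king_dist_sym: "king_dist p q = king_dist q p"
  unfolding king_dist_def by (simp add: abs_minus_commute)

lemma king_dist_triangle: "king_dist p r \<le> king_dist p q + king_dist q r"
  unfolding king_dist_def by linarith

lemma wf_digraph_king_grid: "wf_digraph king_grid"
  by unfold_locales (auto simp: king_grid_def)

lemma verts_H3: "verts (H3 k) = H3_verts k"
  by (simp add: H3_def)

lemma adj_H3: "(p, q) \<in> arcs_ends (H3 k) \<longleftrightarrow> p \<in> H3_verts k \<and> q \<in> H3_verts k \<and> king_dist p q = 1"
proof -
  have "max \<bar>a\<bar> \<bar>b\<bar> = 1 \<longleftrightarrow> nat (max \<bar>a\<bar> \<bar>b\<bar>) = 1" for a b :: int by linarith
  then show ?thesis
    by (cases p; cases q) (force simp: H3_def king_grid_def arcs_ends_conv king_dist_def)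
qed

lemma loopfree_H3: "loopfree_digraph (H3 k)" and nomulti_H3: "nomulti_digraph (H3 k)"
proof -
  interpret wf_digraph "H3 k"
    unfolding H3_def by (rule wf_digraph.wellformed_induce_subgraph[OF wf_digraph_king_grid])
  show "loopfree_digraph (H3 k)" "nomulti_digraph (H3 k)"
    by unfold_locales (auto simp: H3_def king_grid_def arc_to_ends_def)
qed

lemma finite_H3_verts: "finite (H3_verts k)"
proof (rule finite_subset)
  show "H3_verts k \<subseteq> {- 1 .. 2 * int k + 3} \<times> {- int k - 1 .. int k + 2}"
    unfolding H3_verts_def by auto
qed simp

definition H3_corners :: "nat \<Rightarrow> (int \<times> int) set" where
  "H3_corners k = {(int k, - int k - 1), (- 1, 1), (int k + 1, int k + 2), (2 * int k + 2, 0)}"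

lemma H3_corners_subset: "H3_corners k \<subseteq> H3_verts k"
  unfolding H3_corners_def H3_verts_def by auto

lemma king_dist_rotated:
  "2 * int (king_dist p q) = \<bar>(fst p + snd p) - (fst q + snd q)\<bar> + \<bar>(fst p - snd p) - (fst q - snd q)\<bar>"
proof -
  have "2 * max \<bar>a\<bar> \<bar>b\<bar> = \<bar>a + b\<bar> + \<bar>a - b\<bar>" for a b :: int by linarith
  from this[of "fst p - fst q" "snd p - snd q"] show ?thesis
    unfolding king_dist_def by (simp add: algebra_simps le_max_iff_disj)
qed

lemma H3_verts_iff: "(x, y) \<in> H3_verts k \<longleftrightarrow> H3_region (int k) (x + y) (x - y)"
proof -
  have "(x = a \<and> y = b) \<longleftrightarrow> (x + y = a + b \<and> x - y = a - b)" for a b by auto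
  then show ?thesis unfolding H3_verts_def H3_region_def by simp blast
qed

lemma H3_step:
  assumes "p \<in> H3_verts k" "q \<in> H3_verts k" "p \<noteq> q"
  shows "\<exists>r\<in>H3_verts k. king_dist p r = 1 \<and> king_dist p q = king_dist r q + 1"
proof -
  obtain x y x' y' where xy: "p = (x, y)" "q = (x', y')" by (cases p; cases q)
  have "(x + y, x - y) \<noteq> (x' + y', x' - y')" using assms(3) xy by auto
  then obtain a b where ab: "\<bar>a\<bar> + \<bar>b\<bar> = 2" "H3_region (int k) (x + y + a) (x - y + b)"
    "\<bar>x + y - (x' + y')\<bar> + \<bar>x - y - (x' - y')\<bar> =
     \<bar>x + y + a - (x' + y')\<bar> + \<bar>x - y + b - (x' - y')\<bar> + 2"
    using H3_region_step[of "int k" "x + y" "x - y" "x' + y'" "x' - y'"] assms xy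
    by (auto simp: H3_verts_iff H3_step_towards_def)
  \<comment> \<open>In the original coordinates the move changes \<open>x\<close> by half of
    \<open>a + b\<close> and \<open>y\<close> by half of \<open>a - b\<close>.\<close>
  have "even (a + b)" using ab(1) by presburger
  then obtain c where c: "a + b = 2 * c" by (rule evenE)
  let ?r = "(x + c, y + (a - c))"
  have r: "fst ?r + snd ?r = x + y + a" "fst ?r - snd ?r = x - y + b" using c by auto
  have "2 * int (king_dist p ?r) = 2" "2 * int (king_dist p q) = 2 * int (king_dist ?r q) + 2"
    unfolding king_dist_rotated r using ab xy by auto
  moreover have "?r \<in> H3_verts k"
  proof -
    have eqs: "x + c + (y + (a - c)) = x + y + a" "x + c - (y + (a - c)) = x - y + b" using c by auto
    then show ?thesis using ab(2) by (simp only: H3_verts_iff eqs)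
  qed
  ultimately show ?thesis by (intro bexI[of _ ?r]) auto
qed

text \<open>A chain monotone in both rotated coordinates has additive taxicab length, so the boxes
  of \<open>H3_region_between\<close> put both points on one geodesic between opposite
  corners.\<close>

lemma H3_between_corners:
  assumes "p \<in> H3_verts k" "q \<in> H3_verts k" "\<not> (p \<in> H3_corners k \<and> q \<in> H3_corners k)"
  shows "\<exists>P\<in>H3_corners k. \<exists>Q\<in>H3_corners k.
    king_dist P p + king_dist p q + king_dist q Q = king_dist P Q"
proof -
  obtain x y x' y' where xy: "p = (x, y)" "q = (x', y')" by (cases p; cases q)
  let ?eq = "\<lambda>P Q. 2 * int (king_dist P p) + 2 * int (king_dist p q) + 2 * int (king_dist q Q) = 2 * int (king_dist P Q)"
  let ?W = "(- 1, 1)" and ?E = "(2 * int k + 2, 0)" and ?S = "(int k, - int k - 1)" and ?N = "(int k + 1, int k + 2)"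
  define s t s' t' where "s = x + y" and "t = x - y" and "s' = x' + y'" and "t' = x' - y'"
  note st = this
  have inner: "0 \<le> u + v \<and> u + v \<le> 2 * int k + 2 \<and> - 1 \<le> u - v \<and> u - v \<le> 2 * int k + 1"
    if "(u, v) \<in> H3_verts k" "(u, v) \<notin> H3_corners k" for u v
    using that unfolding H3_verts_def H3_corners_def by auto
  have R: "H3_region (int k) s t" "H3_region (int k) s' t'"
    using assms xy by (simp_all add: st flip: H3_verts_iff)
  have grid: "(0 \<le> s \<and> s \<le> 2 * int k + 2 \<and> - 1 \<le> t \<and> t \<le> 2 * int k + 1) \<or>
    (0 \<le> s' \<and> s' \<le> 2 * int k + 2 \<and> - 1 \<le> t' \<and> t' \<le> 2 * int k + 1)"
    using inner[of x y] inner[of x' y'] assms xy unfolding st by blast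
  have line: "\<bar>u0 - u1\<bar> + \<bar>u1 - u2\<bar> + \<bar>u2 - u3\<bar> = \<bar>u0 - u3\<bar>"
    if "u0 \<le> u1 \<and> u1 \<le> u2 \<and> u2 \<le> u3 \<or> u3 \<le> u2 \<and> u2 \<le> u1 \<and> u1 \<le> u0" for u0 u1 u2 u3 :: int
    using that by auto
  have seg: "?eq P Q" if
    "fst P + snd P \<le> s \<and> s \<le> s' \<and> s' \<le> fst Q + snd Q \<or> fst Q + snd Q \<le> s' \<and> s' \<le> s \<and> s \<le> fst P + snd P"
    "fst P - snd P \<le> t \<and> t \<le> t' \<and> t' \<le> fst Q - snd Q \<or> fst Q - snd Q \<le> t' \<and> t' \<le> t \<and> t \<le> fst P - snd P"
    for P Q
    using line[OF that(1)] line[OF that(2)]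
    unfolding king_dist_rotated xy fst_conv snd_conv st[symmetric] by linarith
  have "?eq ?W ?E \<or> ?eq ?E ?W \<or> ?eq ?S ?N \<or> ?eq ?N ?S"
    using H3_region_between[OF of_nat_0_le_iff R grid]
  proof (elim disjE conjE)
    show "?thesis" if "0 \<le> s" "s \<le> s'" "s' \<le> 2 * int k + 2" "- 2 \<le> t" "t \<le> t'" "t' \<le> 2 * int k + 2"
      using seg[of ?W ?E] that by simp
    show "?thesis" if "0 \<le> s'" "s' \<le> s" "s \<le> 2 * int k + 2" "- 2 \<le> t'" "t' \<le> t" "t \<le> 2 * int k + 2"
      using seg[of ?E ?W] that by simp
    show "?thesis" if "- 1 \<le> s" "s \<le> s'" "s' \<le> 2 * int k + 3" "- 1 \<le> t'" "t' \<le> t" "t \<le> 2 * int k + 1"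
      using seg[of ?S ?N] that by simp
    show "?thesis" if "- 1 \<le> s'" "s' \<le> s" "s \<le> 2 * int k + 3" "- 1 \<le> t" "t \<le> t'" "t' \<le> 2 * int k + 1"
      using seg[of ?N ?S] that by simp
  qed
  moreover have "king_dist P p + king_dist p q + king_dist q Q = king_dist P Q" if "?eq P Q" for P Q
    using that by linarith
  ultimately show ?thesis
    unfolding H3_corners_def by blast
qed

text \<open>\<open>H3_step\<close> never leaves \<open>H3 k\<close>, so greedy king moves reach the
  target by a walk inside the subgraph.\<close>

lemma relpow_H3:
  assumes "p \<in> H3_verts k" "q \<in> H3_verts k"
  shows "(p, q) \<in> arcs_ends (H3 k) ^^ king_dist p q"
  using assms
proof (induction "king_dist p q" arbitrary: p)
  case 0
  then have "p = q" by (cases p; cases q) (simp add: king_dist_def)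
  then show ?case by (simp add: king_dist_def)
next
  case (Suc n)
  then have "p \<noteq> q" by (auto simp: king_dist_def)
  then obtain r where r: "r \<in> H3_verts k" "king_dist p r = 1" "king_dist p q = king_dist r q + 1"
    using H3_step Suc.prems by blast
  then have "(r, q) \<in> arcs_ends (H3 k) ^^ n" "(p, r) \<in> arcs_ends (H3 k)"
    using Suc by (auto simp: adj_H3)
  then show ?case using Suc.hyps(2) relpow_Suc_I2 by metis
qed

lemma king_dist_le_relpow: "(p, q) \<in> arcs_ends (H3 k) ^^ n \<Longrightarrow> king_dist p q \<le> n"
proof (induction n arbitrary: q)
  case 0
  then show ?case by (simp add: king_dist_def)
next
  case (Suc n)
  then obtain r where "(p, r) \<in> arcs_ends (H3 k) ^^ n" "(r, q) \<in> arcs_ends (H3 k)" by auto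
  then show ?case
    using Suc.IH[of r] king_dist_triangle[of p q r] by (auto simp: adj_H3)
qed

lemma strongly_connected_H3: "strongly_connected (H3 k)"
proof -
  interpret loopfree_digraph "H3 k" by (rule loopfree_H3)
  have "p \<rightarrow>\<^sup>*\<^bsub>H3 k\<^esub> q" if "p \<in> H3_verts k" "q \<in> H3_verts k" for p q
    using ex_awalk_length_iff[of p q "king_dist p q"] relpow_H3[OF that] that
    unfolding reachable_awalk verts_H3 by blast
  moreover have "H3_verts k \<noteq> {}" unfolding H3_verts_def by auto
  ultimately show ?thesis by (auto simp: strongly_connected_def verts_H3)
qed

lemma gdist_H3:
  assumes "p \<in> H3_verts k" "q \<in> H3_verts k"
  shows "gdist (H3 k) p q = king_dist p q"
proof -
  interpret loopfree_digraph "H3 k" by (rule loopfree_H3)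
  have "gdist (H3 k) p q \<le> king_dist p q"
    using assms relpow_H3 by (intro gdist_le) (auto simp: verts_H3)
  moreover have "king_dist p q \<le> gdist (H3 k) p q"
    using relpow_gdist[of p q] strongly_connected_H3 assms
    by (intro king_dist_le_relpow) (auto simp: strongly_connected_def verts_H3)
  ultimately show ?thesis by simp
qed


text \<open>The corners are sent to the pinwheel and the map is extended nonexpansively. If some
  distance shrank, so would a geodesic between two corners through that pair, contrary to the exact
  corner distances.\<close>

lemma (in integer_hyperconvex) pinwheel_extends:
  assumes pin: "pinwheel k a b c e"
  shows "\<exists>f. f ` H3_verts k \<subseteq> V \<and> (\<forall>p\<in>H3_verts k. \<forall>q\<in>H3_verts k. d (f p) (f q) = king_dist p q)"
proof -
  let ?S = "(int k, - int k - 1)" and ?W = "(- 1, 1) :: int \<times> int"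
    and ?N = "(int k + 1, int k + 2)" and ?E = "(2 * int k + 2, 0) :: int \<times> int"
  \<comment> \<open>Both quadruples are listed cyclically, so \<open>a\<close>, \<open>c\<close> go
    with \<open>?S\<close>, \<open>?N\<close> and \<open>b\<close>, \<open>e\<close> with
    \<open>?W\<close>, \<open>?E\<close>.\<close>
  define f0 where "f0 p = (if p = ?S then a else if p = ?W then b else if p = ?N then c else e)" for p
  have val: "f0 ?S = a" "f0 ?W = b" "f0 ?N = c" "f0 ?E = e"
    unfolding f0_def by auto
  note pin' = pin[unfolded pinwheel_def]
  have kd: "king_dist ?S ?W = k + 2" "king_dist ?W ?N = k + 2" "king_dist ?N ?E = k + 2"
    "king_dist ?S ?E = k + 2" "king_dist ?S ?N = 2 * k + 3" "king_dist ?W ?E = 2 * k + 3"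
    unfolding king_dist_def by auto
  have kd0: "king_dist p p = 0" for p unfolding king_dist_def by simp
  have dist: "d a a = 0" "d b b = 0" "d c c = 0" "d e e = 0"
    "d a b = k + 2" "d b c = k + 2" "d c e = k + 2" "d a e = k + 2" "d a c = 2 * k + 3" "d b e = 2 * k + 3"
    "d b a = k + 2" "d c b = k + 2" "d e c = k + 2" "d e a = k + 2" "d c a = 2 * k + 3" "d e b = 2 * k + 3"
    using pin' d_refl d_sym[of b a] d_sym[of c b] d_sym[of e c] d_sym[of e a] d_sym[of c a] d_sym[of e b]
    by auto
  have kd_rev: "king_dist ?W ?S = k + 2" "king_dist ?N ?W = k + 2" "king_dist ?E ?N = k + 2"
    "king_dist ?E ?S = k + 2" "king_dist ?N ?S = 2 * k + 3" "king_dist ?E ?W = 2 * k + 3"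
    by (subst king_dist_sym, rule kd)+
  have f0: "d (f0 p) (f0 q) = king_dist p q" if "p \<in> H3_corners k" "q \<in> H3_corners k" for p q
    using that unfolding H3_corners_def
    by (elim insertE emptyE) (simp_all only: val kd0 kd kd_rev dist)
  have "\<exists>g. (\<forall>p\<in>H3_corners k. g p = f0 p) \<and> g ` (H3_corners k \<union> H3_verts k) \<subseteq> V \<and>
    (\<forall>p\<in>H3_corners k \<union> H3_verts k. \<forall>q\<in>H3_corners k \<union> H3_verts k. d (g p) (g q) \<le> king_dist p q)"
  proof (rule extend_nonexpansive[OF king_dist_sym king_dist_triangle finite_H3_verts])
    show "finite (H3_corners k)" unfolding H3_corners_def by simp
    show "f0 ` H3_corners k \<subseteq> V" using pin' val unfolding H3_corners_def by auto
  qed (simp add: f0)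
  then obtain g where g: "\<And>p. p \<in> H3_corners k \<Longrightarrow> g p = f0 p" "g ` H3_verts k \<subseteq> V"
    "\<And>p q. p \<in> H3_verts k \<Longrightarrow> q \<in> H3_verts k \<Longrightarrow> d (g p) (g q) \<le> king_dist p q"
    using H3_corners_subset by (metis sup.absorb2)
  have "d (g p) (g q) = king_dist p q" if pq: "p \<in> H3_verts k" "q \<in> H3_verts k" for p q
  proof (cases "p \<in> H3_corners k \<and> q \<in> H3_corners k")
    case True
    then show ?thesis using g(1) f0 by simp
  next
    case False
    obtain P Q where PQ: "P \<in> H3_corners k" "Q \<in> H3_corners k"
      "king_dist P p + king_dist p q + king_dist q Q = king_dist P Q"
      using H3_between_corners[OF pq False] by blast
    then have V: "P \<in> H3_verts k" "Q \<in> H3_verts k" using H3_corners_subset by auto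
    have "king_dist P Q = d (g P) (g Q)" using PQ g(1) f0 by simp
    also have "\<dots> \<le> d (g P) (g p) + d (g p) (g Q)"
      using V pq g(2) by (intro d_triangle) auto
    also have "\<dots> \<le> d (g P) (g p) + (d (g p) (g q) + d (g q) (g Q))"
      using V pq g(2) by (intro add_left_mono d_triangle) auto
    finally show ?thesis
      using g(3)[OF V(1) pq(1)] g(3)[OF pq] g(3)[OF pq(2) V(2)] PQ(3) by linarith
  qed
  then show ?thesis using g(2) by blast
qed

section \<open>Helly graphs\<close>

locale helly_graph = graph G for G :: "('a, 'b) pre_digraph" (structure) +
  assumes connected: "Digraph_Component.connected G"
    and helly: "helly G"
begin

lemma reachable: "u \<in> verts G \<Longrightarrow> v \<in> verts G \<Longrightarrow> u \<rightarrow>\<^sup>* v"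
  using symmetric_connected_imp_strongly_connected[OF sym_arcs connected]
  by (auto simp: strongly_connected_def)

lemma verts_nonempty: "verts G \<noteq> {}"
  using symmetric_connected_imp_strongly_connected[OF sym_arcs connected]
  by (auto simp: strongly_connected_def)

sublocale integer_hyperconvex "verts G" "gdist G"
proof
  fix x y z
  show "x \<in> verts G \<Longrightarrow> gdist G x x = 0" by (rule gdist_refl)
  show "x \<in> verts G \<Longrightarrow> y \<in> verts G \<Longrightarrow> gdist G x y = gdist G y x"
    by (intro gdist_sym reachable)
  show "x \<in> verts G \<Longrightarrow> y \<in> verts G \<Longrightarrow> z \<in> verts G \<Longrightarrow> gdist G x z \<le> gdist G x y + gdist G y z"
    by (intro gdist_triangle reachable)
next
  fix F :: "('a \<times> nat) set"
  assume F: "F \<subseteq> verts G \<times> UNIV"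
    and close: "\<And>x r y s. (x, r) \<in> F \<Longrightarrow> (y, s) \<in> F \<Longrightarrow> gdist G x y \<le> r + s"
  have meet: "disk G x r \<inter> disk G y s \<noteq> {}" if xy: "(x, r) \<in> F" "(y, s) \<in> F" for x r y s
  proof -
    have V: "x \<in> verts G" "y \<in> verts G" using F xy by auto
    \<comment> \<open>The minimum covers a radius \<open>r\<close> beyond the distance, where the
      geodesic is cut at its end \<open>y\<close>.\<close>
    have "gdist G x y = min r (gdist G x y) + (gdist G x y - min r (gdist G x y))" by simp
    from gdist_split[OF reachable[OF V] this] obtain w where
      "w \<in> verts G" "gdist G x w \<le> min r (gdist G x y)" "gdist G w y \<le> gdist G x y - min r (gdist G x y)" .
    then have "w \<in> disk G x r \<inter> disk G y s"
      using close[OF xy] gdist_sym[OF reachable, of x w] V unfolding disk_def by auto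
    then show ?thesis by blast
  qed
  let ?D = "(\<lambda>(x, r). disk G x r) ` F"
  have "?D \<subseteq> {disk G v r | v r. v \<in> verts G}" using F by auto
  moreover have "\<forall>A\<in>?D. \<forall>B\<in>?D. A \<inter> B \<noteq> {}" using meet by auto
  ultimately obtain c where c: "c \<in> verts G" "\<forall>A\<in>?D. c \<in> A"
    using helly unfolding helly_def by meson
  then have "\<forall>(x, r)\<in>F. gdist G c x \<le> r"
    unfolding disk_def by fastforce
  with c(1) show "\<exists>c\<in>verts G. \<forall>(x, r)\<in>F. gdist G c x \<le> r" by blast
qed

section \<open>Thinness and hyperbolicity as attained maxima\<close>

lemma finite_slice_distances:
  "finite {gdist G u v | u v x y j. x \<in> verts G \<and> y \<in> verts G \<and> u \<in> slice G j x y \<and> v \<in> slice G j x y}"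
    (is "finite ?T")
proof (rule finite_subset)
  show "?T \<subseteq> (\<lambda>(u, v). gdist G u v) ` (verts G \<times> verts G)"
    unfolding slice_def interval_def by auto
qed simp

lemma thinness_ge:
  assumes "x \<in> verts G" "y \<in> verts G" "u \<in> slice G j x y" "v \<in> slice G j x y"
  shows "gdist G u v \<le> thinness G"
  unfolding thinness_def using assms by (intro Max_ge finite_slice_distances) blast

lemma thinness_attained:
  obtains x y u v j where "x \<in> verts G" "y \<in> verts G" "u \<in> slice G j x y" "v \<in> slice G j x y"
    "gdist G u v = thinness G"
proof -
  obtain x where x: "x \<in> verts G" using verts_nonempty by blast
  then have "x \<in> slice G 0 x x" unfolding slice_def interval_def by (simp add: gdist_refl)
  then have "thinness G \<in> {gdist G u v | u v x y j. x \<in> verts G \<and> y \<in> verts G \<and>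
    u \<in> slice G j x y \<and> v \<in> slice G j x y}"
    unfolding thinness_def using x by (intro Max_in finite_slice_distances) blast
  then show thesis using that by force
qed

lemma thin_thinness: "thin (thinness G)"
  unfolding thin_def
proof (intro ballI impI)
  fix x y u v
  assume "x \<in> verts G" "y \<in> verts G" "u \<in> verts G" "v \<in> verts G"
    "gdist G x u + gdist G u y = gdist G x y" "gdist G x v + gdist G v y = gdist G x y"
    "gdist G x u = gdist G x v"
  then show "gdist G u v \<le> thinness G"
    by (intro thinness_ge[of x y u "gdist G x u"]) (auto simp: slice_def interval_def)
qed

lemma finite_quad_hbs:
  "finite {quad_hb G u v w x | u v w x. u \<in> verts G \<and> v \<in> verts G \<and> w \<in> verts G \<and> x \<in> verts G}"
    (is "finite ?T")
proof (rule finite_subset)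
  show "?T \<subseteq> (\<lambda>(u, v, w, x). quad_hb G u v w x) ` (verts G \<times> verts G \<times> verts G \<times> verts G)"
    by force
qed simp

lemma hb_ge:
  assumes "u \<in> verts G" "v \<in> verts G" "w \<in> verts G" "x \<in> verts G"
  shows "quad_hb G u v w x \<le> hb G"
  unfolding hb_def using assms by (intro Max_ge finite_quad_hbs) blast

lemma hb_attained:
  obtains u v w x where "u \<in> verts G" "v \<in> verts G" "w \<in> verts G" "x \<in> verts G"
    "quad_hb G u v w x = hb G"
proof -
  obtain x where "x \<in> verts G" using verts_nonempty by blast
  then have "hb G \<in> {quad_hb G u v w x | u v w x. u \<in> verts G \<and> v \<in> verts G \<and> w \<in> verts G \<and> x \<in> verts G}"
    unfolding hb_def by (intro Max_in finite_quad_hbs) blast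
  then show thesis using that by force
qed

lemma two_quad_hb_ge:
  assumes "\<delta> + (gdist G u v + gdist G w x) \<le> gdist G u w + gdist G v x"
    "\<delta> + (gdist G u x + gdist G v w) \<le> gdist G u w + gdist G v x"
  shows "real \<delta> \<le> 2 * quad_hb G u v w x"
  using assms unfolding quad_hb_def Let_def by (auto simp: numeral_2_eq_2)

text \<open>Relabelling puts the largest sum on the pairs \<open>u\<close>, \<open>w\<close> and
  \<open>v\<close>, \<open>x\<close>, the form that \<open>thin_or_pinwheel\<close> takes. Doubling
  makes the excess a natural number.\<close>

lemma quad_hb_ordered:
  assumes "a \<in> verts G" "b \<in> verts G" "c \<in> verts G" "e \<in> verts G"
  obtains u v w x \<delta> where "u \<in> verts G" "v \<in> verts G" "w \<in> verts G" "x \<in> verts G"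
    "2 * quad_hb G a b c e = real \<delta>"
    "\<delta> + gdist G u v + gdist G w x \<le> gdist G u w + gdist G v x"
    "\<delta> + gdist G u x + gdist G v w \<le> gdist G u w + gdist G v x"
proof -
  let ?P = "gdist G a b + gdist G c e" and ?Q = "gdist G a c + gdist G b e" and ?R = "gdist G a e + gdist G b c"
  have sym: "gdist G c b = gdist G b c" "gdist G e c = gdist G c e" "gdist G e b = gdist G b e"
    using assms by (auto intro: d_sym)
  define \<delta> where "\<delta> = nat (int (sort [?P, ?Q, ?R] ! 2) - int (sort [?P, ?Q, ?R] ! 1))"
  \<comment> \<open>The nested maximum and minimum is the median of the three sums, the entry at
    index 1 of the sorted list.\<close>
  have \<delta>: "2 * quad_hb G a b c e = real \<delta>"
    "\<delta> + max (min ?P ?Q) (min (max ?P ?Q) ?R) = max ?P (max ?Q ?R)"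
    unfolding \<delta>_def quad_hb_def Let_def by (auto simp: numeral_2_eq_2)
  consider "?Q \<le> ?P" "?R \<le> ?P" | "?P \<le> ?Q" "?R \<le> ?Q" | "?P \<le> ?R" "?Q \<le> ?R"
    by linarith
  then show thesis
  proof cases
    case 1
    then show thesis using \<delta> assms sym by (intro that[of a c b e \<delta>]) (auto simp: max_def min_def split: if_splits)
  next
    case 2
    then show thesis using \<delta> assms sym by (intro that[of a b c e \<delta>]) (auto simp: max_def min_def split: if_splits)
  next
    case 3
    then show thesis using \<delta> assms sym by (intro that[of a b e c \<delta>]) (auto simp: max_def min_def split: if_splits)
  qed
qed

text \<open>For \<open>u\<close>, \<open>v\<close> in one slice between \<open>x\<close> and
  \<open>y\<close>, two sums of the quadruple equal the distance of \<open>x\<close> and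
  \<open>y\<close>, and the third is larger by the distance of \<open>u\<close> and
  \<open>v\<close>.\<close>

lemma thinness_le_two_hb: "real (thinness G) \<le> 2 * hb G"
proof -
  obtain x y u v j where xy: "x \<in> verts G" "y \<in> verts G" "u \<in> slice G j x y" "v \<in> slice G j x y"
    and uv: "gdist G u v = thinness G" by (rule thinness_attained)
  then have V: "u \<in> verts G" "v \<in> verts G" and dist: "gdist G x u = j" "gdist G x v = j"
    "j + gdist G u y = gdist G x y" "j + gdist G v y = gdist G x y"
    by (auto simp: slice_def interval_def)
  have "real (thinness G) \<le> 2 * quad_hb G x u y v"
    using dist uv d_sym[of y v] d_sym[of y u] xy(2) V by (intro two_quad_hb_ge) auto
  also have "\<dots> \<le> 2 * hb G" using hb_ge xy(1,2) V by simp
  finally show ?thesis .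
qed

lemma two_hb_dichotomy:
  "2 * hb G \<le> real (thinness G) \<or> 2 * hb G = real (thinness G) + 1 \<and> odd (thinness G) \<and>
    (\<exists>a b c e. pinwheel (thinness G div 2) a b c e)"
proof -
  obtain a b c e where abce: "a \<in> verts G" "b \<in> verts G" "c \<in> verts G" "e \<in> verts G"
    "quad_hb G a b c e = hb G" by (rule hb_attained)
  obtain u v w x \<delta> where ux: "u \<in> verts G" "v \<in> verts G" "w \<in> verts G" "x \<in> verts G"
    "2 * quad_hb G a b c e = real \<delta>"
    "\<delta> + gdist G u v + gdist G w x \<le> gdist G u w + gdist G v x"
    "\<delta> + gdist G u x + gdist G v w \<le> gdist G u w + gdist G v x"
    by (rule quad_hb_ordered[OF abce(1-4)])
  from thin_or_pinwheel[OF ux(1-4,6,7) thin_thinness] show ?thesis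
    using ux(5) abce(5) by auto
qed

lemma two_hb_ge_pinwheel:
  assumes "pinwheel k a b c e"
  shows "real (2 * k + 2) \<le> 2 * hb G"
proof -
  note pin = assms[unfolded pinwheel_def]
  have "real (2 * k + 2) \<le> 2 * quad_hb G a b c e"
    using pin by (intro two_quad_hb_ge) auto
  also have "\<dots> \<le> 2 * hb G" using hb_ge pin by simp
  finally show ?thesis .
qed

text \<open>Reduces the search for a subgraph to four vertices: the corners of an embedded copy form
  a pinwheel, and \<open>pinwheel_extends\<close> gives the converse.\<close>

lemma contains_H3_iff_pinwheel: "contains_isometric G (H3 k) \<longleftrightarrow> (\<exists>a b c e. pinwheel k a b c e)"
proof -
  have "contains_isometric G (H3 k) \<longleftrightarrow> (\<exists>f. f ` H3_verts k \<subseteq> verts G \<and>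
    (\<forall>p\<in>H3_verts k. \<forall>q\<in>H3_verts k. gdist G (f p) (f q) = king_dist p q))"
    using contains_isometric_iff[OF graph_axioms connected loopfree_H3 nomulti_H3 strongly_connected_H3]
    by (simp add: verts_H3 gdist_H3)
  also have "\<dots> \<longleftrightarrow> (\<exists>a b c e. pinwheel k a b c e)"
  proof
    assume "\<exists>f. f ` H3_verts k \<subseteq> verts G \<and>
      (\<forall>p\<in>H3_verts k. \<forall>q\<in>H3_verts k. gdist G (f p) (f q) = king_dist p q)"
    then obtain f where f: "f ` H3_verts k \<subseteq> verts G"
      "\<And>p q. p \<in> H3_verts k \<Longrightarrow> q \<in> H3_verts k \<Longrightarrow> gdist G (f p) (f q) = king_dist p q" by blast
    have corner: "(int k, - int k - 1) \<in> H3_verts k" "(- 1, 1) \<in> H3_verts k"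
      "(int k + 1, int k + 2) \<in> H3_verts k" "(2 * int k + 2, 0) \<in> H3_verts k"
      using H3_corners_subset unfolding H3_corners_def by auto
    have "pinwheel k (f (int k, - int k - 1)) (f (- 1, 1)) (f (int k + 1, int k + 2)) (f (2 * int k + 2, 0))"
      unfolding pinwheel_def using f corner by (auto simp: king_dist_def)
    then show "\<exists>a b c e. pinwheel k a b c e" by blast
  qed (use pinwheel_extends in blast)
  finally show ?thesis .
qed

end

theorem theorem2:
  fixes G :: "('a, 'b) pre_digraph"
  assumes "graph G" and "Digraph_Component.connected G" and "helly G"
  shows "real (thinness G) \<le> 2 * hb G \<and> 2 * hb G \<le> real (thinness G) + 1 \<and>
    (2 * hb G = real (thinness G) + 1 \<longleftrightarrow>
      odd (thinness G) \<and> contains_isometric G (H3 (thinness G div 2)))"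
proof -
  interpret helly_graph G
    using assms by (simp add: helly_graph_def helly_graph_axioms_def)
  \<comment> \<open>For odd thinness the rounding in \<open>thinness G div 2\<close> loses one half,
    so the value 2k + 2 of a pinwheel is the thinness plus 1.\<close>
  have "real (thinness G) + 1 \<le> 2 * hb G"
    if "odd (thinness G)" "pinwheel (thinness G div 2) a b c e" for a b c e
  proof -
    have "2 * (thinness G div 2) + 2 = thinness G + 1" using that(1) by presburger
    then show ?thesis using two_hb_ge_pinwheel[OF that(2)] by simp
  qed
  then show ?thesis
    using thinness_le_two_hb two_hb_dichotomy unfolding contains_H3_iff_pinwheel by fastforce
qed

end
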